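(* Let $P$ be a finite poset that is not an antichain. Then $$\mathrm{forb}^*(n,P)\leq 2^{O(\mathrm{La}^*(n,P))},$$ that is, there exists a constant $K$ depending only on $P$ such that for all positive integers $n$, $\mathrm{forb}^*(n,P)\le 2^{K\cdot \mathrm{La}^*(n,P)}$.
   Context: $[n]=\{1,\dots,n\}$, and the Boolean lattice $2^{[n]}$ is the power set of $[n]$ partially ordered by inclusion. A poset $Q$ contains an induced copy of a finite poset $P$ if there is an injective map $f:P\to Q$ such that $f(x)<_Q f(y)$ if and only if $x<_P y$. A family $\mathcal F\subseteq 2^{[n]}$ (ordered by inclusion) is induced $P$-free if it contains no induced copy of $P$. $\mathrm{La}^*(n,P)$ is the largest size of an induced $P$-free family $\mathcal F\subseteq 2^{[n]}$, and $\mathrm{forb}^*(n,P)$ is the number of induced $P$-free families $\mathcal F\subseteq 2^{[n]}$. *)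

theory Defs
  imports Complex_Main
begin

(* A poset is a set P of elements of a type of class order, with the order of that type.
   On a type of sets, (<) is strict inclusion, so a family of sets is ordered by inclusion. *)

definition is_antichain :: "'a::order set \<Rightarrow> bool" where
  "is_antichain P \<longleftrightarrow> (\<forall>x\<in>P. \<forall>y\<in>P. \<not> x < y)"

definition contains_induced_copy :: "'b::order set \<Rightarrow> 'a::order set \<Rightarrow> bool" where
  "contains_induced_copy Q P \<longleftrightarrow>
     (\<exists>f. inj_on f P \<and> f ` P \<subseteq> Q \<and> (\<forall>x\<in>P. \<forall>y\<in>P. f x < f y \<longleftrightarrow> x < y))"

definition induced_free_families :: "nat \<Rightarrow> 'a::order set \<Rightarrow> nat set set set" where
  "induced_free_families n P = {F. F \<subseteq> Pow {1..n} \<and> \<not> contains_induced_copy F P}"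

(* For P nonempty the maximum is over a nonempty finite set: the empty family is P-free. *)
definition La_star :: "nat \<Rightarrow> 'a::order set \<Rightarrow> nat" where
  "La_star n P = Max (card ` induced_free_families n P)"

definition forb_star :: "nat \<Rightarrow> 'a::order set \<Rightarrow> nat" where
  "forb_star n P = card (induced_free_families n P)"

end

theory Submission
  imports Defs "HOL-Library.FuncSet" "HOL-Analysis.Convex" "HOL-Combinatorics.Permutations"
begin

text \<open>Let \<open>d = card P\<close>, which is at least two. The middle level of the lattice of subsets of \<open>{1..n}\<close> is an
antichain and therefore contains no copy of \<open>P\<close>; so it suffices to bound the number of induced \<open>P\<close>-free
families by \<open>2\<close> to the order of the central binomial coefficient.

The poset embeds into a \<open>d\<close>-dimensional grid (\<open>ex_realizer\<close>). Cutting the ground set into \<open>d\<close> blocks and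
taking initial segments of the blocks embeds such a grid, of side of order \<open>n\<close>, into the Boolean
lattice, and a \<open>P\<close>-free family meets it in a set of grid points that avoids a fixed pattern. By the
Klazar--Marcus theorem (\<open>pattern_free_bound\<close>) such a set has at most order of \<open>n ^ (d - 1)\<close> points,
and repeated coarsening of the grid turns this into a bound \<open>2\<close> to the order of \<open>n ^ (d - 1)\<close> on the
number of these sets (\<open>count_pattern_free\<close>).

The local bounds are assembled by Shearer's inequality (\<open>shearer_inequality\<close>), applied to the images of
the grid under all permutations of the ground set. A level near the middle meets the grid in at
least order of \<open>n ^ (d - 1)\<close> sets, so a set on that level lies in a proportion of at
least order of \<open>n ^ (d - 1)\<close> over the central binomial coefficient of these images
(\<open>card_permutations_covering\<close>). The two powers of \<open>n\<close> cancel and leave the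
central binomial coefficient in the exponent (\<open>middle_families_bound\<close>). The sets far from the middle
are by Chebyshev's inequality at most a constant times as many as the sets of the
middle level (\<open>card_far_from_middle\<close>), and each of them at most doubles the number of families.\<close>

section \<open>Pattern-free sets in grids\<close>

definition grid :: "'i set \<Rightarrow> nat \<Rightarrow> ('i \<Rightarrow> nat) set" where
  "grid I q = (I \<rightarrow>\<^sub>E {..<q})"

text \<open>A finite poset of order dimension at most \<open>card I\<close> is described by one function \<open>g i\<close> for each
coordinate \<open>i\<close>. Only strict inequalities are demanded of the copy; this is what survives when the
grid is coarsened, since points whose blocks differ in a coordinate are ordered in it as the blocks are.\<close>
definition has_pattern ::
  "('i \<Rightarrow> 'p \<Rightarrow> nat) \<Rightarrow> 'i set \<Rightarrow> 'p set \<Rightarrow> ('i \<Rightarrow> nat) set \<Rightarrow> bool" where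
  "has_pattern g I P A \<longleftrightarrow>
     (\<exists>\<phi>. \<phi> ` P \<subseteq> A \<and> (\<forall>i\<in>I. \<forall>x\<in>P. \<forall>y\<in>P. g i x < g i y \<longrightarrow> \<phi> x i < \<phi> y i))"

lemma has_patternI:
  assumes "\<And>x. x \<in> P \<Longrightarrow> \<phi> x \<in> A"
    and "\<And>i x y. i \<in> I \<Longrightarrow> x \<in> P \<Longrightarrow> y \<in> P \<Longrightarrow> g i x < g i y \<Longrightarrow> \<phi> x i < \<phi> y i"
  shows "has_pattern g I P A"
  unfolding has_pattern_def using assms by (intro exI[of _ \<phi>]) auto

lemma has_patternE:
  assumes "has_pattern g I P A"
  obtains \<phi> where "\<And>x. x \<in> P \<Longrightarrow> \<phi> x \<in> A"
    and "\<And>i x y. i \<in> I \<Longrightarrow> x \<in> P \<Longrightarrow> y \<in> P \<Longrightarrow> g i x < g i y \<Longrightarrow> \<phi> x i < \<phi> y i"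
proof -
  from assms obtain \<phi> where "\<phi> ` P \<subseteq> A"
      "\<forall>i\<in>I. \<forall>x\<in>P. \<forall>y\<in>P. g i x < g i y \<longrightarrow> \<phi> x i < \<phi> y i"
    unfolding has_pattern_def by (elim exE conjE)
  then show thesis by (intro that[of \<phi>]) auto
qed

definition coarsen :: "'i set \<Rightarrow> nat \<Rightarrow> ('i \<Rightarrow> nat) \<Rightarrow> 'i \<Rightarrow> nat" where
  "coarsen I s a = (\<lambda>i\<in>I. a i div s)"

abbreviation block :: "'i set \<Rightarrow> nat \<Rightarrow> ('i \<Rightarrow> nat) set \<Rightarrow> ('i \<Rightarrow> nat) \<Rightarrow> ('i \<Rightarrow> nat) set" where
  "block I s A b \<equiv> {a \<in> A. coarsen I s a = b}"

lemma finite_grid [simp]: "finite I \<Longrightarrow> finite (grid I q)"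
  by (simp add: grid_def finite_PiE)

lemma card_grid: "finite I \<Longrightarrow> card (grid I q) = q ^ card I"
  by (simp add: grid_def card_PiE)

lemma coarsen_in_grid:
  assumes "a \<in> grid I (s ^ Suc j)"
  shows "coarsen I s a \<in> grid I (s ^ j)"
proof -
  have "a i div s < s ^ j" if "i \<in> I" for i
    by (rule less_mult_imp_div_less) (use assms that in \<open>auto simp: grid_def PiE_iff mult.commute[of s]\<close>)
  then show ?thesis by (simp add: coarsen_def grid_def)
qed

text \<open>Picking one point of \<open>A\<close> in every block of the copy gives a copy in \<open>A\<close>: a strict inequality between
block indices is inherited by all points of the blocks. So coarsening keeps a set pattern-free, which
drives both the bound on the size of a pattern-free set and the bound on the number of such sets.\<close>
lemma has_pattern_of_coarsen:
  assumes "has_pattern g I P (coarsen I s ` A)"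
  shows "has_pattern g I P A"
proof -
  obtain \<phi> where \<phi>: "\<And>x. x \<in> P \<Longrightarrow> \<phi> x \<in> coarsen I s ` A"
    and less: "\<And>i x y. i \<in> I \<Longrightarrow> x \<in> P \<Longrightarrow> y \<in> P \<Longrightarrow> g i x < g i y \<Longrightarrow> \<phi> x i < \<phi> y i"
    using has_patternE[OF assms] by metis
  have "\<forall>x\<in>P. \<exists>a\<in>A. \<phi> x = coarsen I s a" using \<phi> by blast
  then obtain \<psi> where \<psi>: "\<And>x. x \<in> P \<Longrightarrow> \<psi> x \<in> A \<and> \<phi> x = coarsen I s (\<psi> x)"
    by metis
  have "\<psi> x i < \<psi> y i" if "i \<in> I" "x \<in> P" "y \<in> P" "g i x < g i y" for i x y
  proof -
    have "\<psi> x i div s < \<psi> y i div s"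
      using less[OF that] \<psi> that by (simp add: coarsen_def)
    then show ?thesis by (meson div_le_mono not_le)
  qed
  with \<psi> show ?thesis by (intro has_patternI[of _ \<psi>]) auto
qed

lemma card_le_of_projections:
  fixes B :: "('i \<Rightarrow> nat) set"
  assumes "finite I" "B \<subseteq> extensional I" "finite B"
    and "\<And>i. i \<in> I \<Longrightarrow> card ((\<lambda>a. a i) ` B) \<le> m"
  shows "card B \<le> m ^ card I"
proof -
  have "B \<subseteq> (\<Pi>\<^sub>E i\<in>I. (\<lambda>a. a i) ` B)"
    using assms(2) by (auto simp: PiE_def)
  then have "card B \<le> card (\<Pi>\<^sub>E i\<in>I. (\<lambda>a. a i) ` B)"
    using assms by (intro card_mono finite_PiE) auto
  also have "\<dots> = (\<Prod>i\<in>I. card ((\<lambda>a. a i) ` B))"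
    using assms(1) by (simp add: card_PiE)
  also have "\<dots> \<le> (\<Prod>i\<in>I. m)"
    using assms(4) by (intro prod_mono) auto
  finally show ?thesis by simp
qed

lemma block_projection:
  assumes "i \<in> I" "0 < s"
  shows "(\<lambda>a. a i) ` block I s A b \<subseteq> {b i * s..<b i * s + s}"
proof -
  have "u div s * s \<le> u \<and> u < u div s * s + s" for u
    using div_mult_mod_eq[of u s] mod_less_divisor[OF assms(2), of u] by linarith
  then show ?thesis
    using assms(1) by (force simp: coarsen_def)
qed

lemma card_block_le:
  assumes "finite I" "A \<subseteq> grid I q" "0 < s"
  shows "card (block I s A b) \<le> s ^ card I"
proof (rule card_le_of_projections[OF assms(1)])
  show "block I s A b \<subseteq> extensional I"
    using assms(2) by (auto simp: grid_def PiE_def)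
  show "finite (block I s A b)"
    using finite_subset[OF assms(2)] assms(1) by simp
  fix i assume "i \<in> I"
  then show "card ((\<lambda>a. a i) ` block I s A b) \<le> s"
    using card_mono[OF _ block_projection[OF _ assms(3), where I = I and i = i and A = A and b = b]] by simp
qed

lemma strictly_monotone_choice:
  fixes h :: "'p \<Rightarrow> nat" and T :: "nat set"
  assumes "finite P" "finite T" "card P \<le> card T"
  shows "\<exists>t. t ` P \<subseteq> T \<and> (\<forall>x\<in>P. \<forall>y\<in>P. h x < h y \<longrightarrow> t x < t y)"
proof -
  define rank where "rank x = card {z\<in>P. h z < h x}" for x
  define t where "t x = sorted_list_of_set T ! rank x" for x
  have rank: "rank x < card T" if "x \<in> P" for x
  proof -
    have "rank x < card P"
      unfolding rank_def using assms(1) that by (intro psubset_card_mono) auto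
    then show ?thesis using assms(3) by simp
  qed
  have "t x \<in> T" if "x \<in> P" for x
    using nth_mem[of "rank x" "sorted_list_of_set T"] rank[OF that] assms(2)
    by (simp add: t_def)
  moreover have "t x < t y" if "x \<in> P" "y \<in> P" "h x < h y" for x y
  proof -
    have "rank x < rank y"
      unfolding rank_def using assms(1) that by (intro psubset_card_mono) auto
    moreover have "sorted_wrt (<) (sorted_list_of_set T)" by simp
    ultimately show ?thesis
      unfolding t_def using rank[OF that(2)] assms(2) by (intro sorted_wrt_nth_less[of "(<)"]) auto
  qed
  ultimately show ?thesis by blast
qed

text \<open>The reason for counting wide blocks in one dimension less. If the blocks in \<open>B\<close> all have the same
projection \<open>U\<close> to coordinate \<open>i\<close>, then coordinate \<open>i\<close> can be prescribed freely: a copy of the pattern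
in the remaining coordinates lifts to a full copy, because each of its blocks contains a point
with any wanted value from \<open>U\<close>, and \<open>U\<close> is large enough to realise the order of \<open>g i\<close>.\<close>
lemma pattern_free_of_common_projection:
  assumes "finite P" "finite U" "card P \<le> card U" "i \<in> I"
    and free: "\<not> has_pattern g I P A"
    and B: "\<And>b. b \<in> B \<Longrightarrow> (\<lambda>a. a i) ` block I s A b = U"
  shows "\<not> has_pattern g (I - {i}) P ((\<lambda>b. restrict b (I - {i})) ` B)"
proof
  assume "has_pattern g (I - {i}) P ((\<lambda>b. restrict b (I - {i})) ` B)"
  then obtain \<phi> where \<phi>: "\<And>x. x \<in> P \<Longrightarrow> \<phi> x \<in> (\<lambda>b. restrict b (I - {i})) ` B"
    and less: "\<And>i' x y. i' \<in> I - {i} \<Longrightarrow> x \<in> P \<Longrightarrow> y \<in> P \<Longrightarrow> g i' x < g i' y \<Longrightarrow> \<phi> x i' < \<phi> y i'"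
    by (elim has_patternE) metis
  obtain t where t: "t ` P \<subseteq> U" "\<forall>x\<in>P. \<forall>y\<in>P. g i x < g i y \<longrightarrow> t x < t y"
    using strictly_monotone_choice[OF assms(1-3), of "g i"] by (elim exE conjE)
  have "\<exists>a\<in>A. a i = t x \<and> (\<forall>i'\<in>I - {i}. \<phi> x i' = a i' div s)" if x: "x \<in> P" for x
  proof -
    obtain b where b: "b \<in> B" "\<phi> x = restrict b (I - {i})" using \<phi>[OF x] by blast
    have "t x \<in> (\<lambda>a. a i) ` block I s A b" using t(1) x B[OF b(1)] by blast
    then obtain a where "a \<in> A" "coarsen I s a = b" "a i = t x" by (auto simp: image_iff)
    then show ?thesis using b(2) by (auto simp: coarsen_def)
  qed
  then obtain \<psi> where \<psi>: "\<And>x. x \<in> P \<Longrightarrow> \<psi> x \<in> A \<and> \<psi> x i = t x \<and> (\<forall>i'\<in>I - {i}. \<phi> x i' = \<psi> x i' div s)"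
    by metis
  have "\<psi> x i' < \<psi> y i'" if "i' \<in> I" "x \<in> P" "y \<in> P" "g i' x < g i' y" for i' x y
  proof (cases "i' = i")
    case True
    then show ?thesis using \<psi> t(2) that by auto
  next
    case False
    then have "\<psi> x i' div s < \<psi> y i' div s"
      using less[of i' x y] \<psi> that by auto
    then show ?thesis by (meson div_le_mono not_le)
  qed
  then have "has_pattern g I P A" using \<psi> by (intro has_patternI[of _ \<psi>]) auto
  with free show False by simp
qed

text \<open>A block is wide in direction \<open>i\<close> if its points have at least \<open>card P\<close> values in coordinate \<open>i\<close>.
Such blocks are sorted by the set \<open>U\<close> of these values. As \<open>U\<close> lies in one interval of
length \<open>s\<close>, it takes at most \<open>s ^ j * 2 ^ s\<close> values, and it determines coordinate \<open>i\<close> of the block; so the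
blocks with projection \<open>U\<close> are in bijection with a pattern-free set of one dimension less.\<close>
lemma card_wide_blocks_le:
  assumes "finite I" "i \<in> I" "finite P" "P \<noteq> {}" "0 < s"
    and A: "A \<subseteq> grid I (s ^ Suc j)" and free: "\<not> has_pattern g I P A"
    and C: "\<And>B. B \<subseteq> grid (I - {i}) (s ^ j) \<Longrightarrow> \<not> has_pattern g (I - {i}) P B \<Longrightarrow> card B \<le> C"
  shows "card {b \<in> coarsen I s ` A. card P \<le> card ((\<lambda>a. a i) ` block I s A b)}
           \<le> s ^ j * 2 ^ s * C"
proof -
  define W where "W = {b \<in> coarsen I s ` A. card P \<le> card ((\<lambda>a. a i) ` block I s A b)}"
  define proj where "proj b = (\<lambda>a. a i) ` block I s A b" for b
  define \<U> where "\<U> = (\<Union>v<s ^ j. Pow {v * s..<v * s + s})"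
  have W_grid: "W \<subseteq> grid I (s ^ j)"
    using A coarsen_in_grid unfolding W_def by blast
  have fin_W: "finite W" using W_grid assms(1) finite_subset finite_grid by blast
  have fin_\<U>: "finite \<U>" by (simp add: \<U>_def)
  have proj_block: "proj b \<subseteq> {b i * s..<b i * s + s}" for b
    unfolding proj_def by (rule block_projection[OF assms(2,5)])
  have proj: "proj b \<in> \<U>" if "b \<in> W" for b
  proof -
    have "b i < s ^ j" using that W_grid assms(2) by (auto simp: grid_def PiE_iff)
    then show ?thesis unfolding \<U>_def by (intro UN_I[of "b i"] PowI proj_block) simp
  qed
  have fibre: "card {b \<in> W. proj b = U} \<le> C" for U
  proof (cases "{b \<in> W. proj b = U} = {}")
    case True
    then show ?thesis by (simp only: card.empty)
  next
    case False
    then obtain b0 where b0: "b0 \<in> W" "proj b0 = U" by blast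
    have U: "card P \<le> card U" "finite U"
      using b0 proj_block[of b0] finite_subset by (auto simp: W_def proj_def)
    then have "U \<noteq> {}" using assms(3,4) by auto
    then obtain u where u: "u \<in> U" by blast
    let ?B = "{b \<in> W. proj b = U}"
    let ?r = "\<lambda>b. restrict b (I - {i})"
    have bi: "b i = u div s" if "b \<in> ?B" for b
    proof -
      have "u \<in> proj b" using that u by simp
      then show ?thesis unfolding proj_def using assms(2) by (auto simp: coarsen_def)
    qed
    have "inj_on ?r ?B"
    proof (rule inj_onI)
      fix b c assume bc: "b \<in> ?B" "c \<in> ?B" "?r b = ?r c"
      have "b k = c k" if "k \<in> I" for k
      proof (cases "k = i")
        case True
        then show ?thesis using bi[OF bc(1)] bi[OF bc(2)] by simp
      next
        case False
        then show ?thesis using fun_cong[OF bc(3), of k] that by simp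
      qed
      moreover have "b \<in> extensional I" "c \<in> extensional I"
        using bc W_grid by (auto simp: grid_def PiE_def)
      ultimately show "b = c" by (meson extensionalityI)
    qed
    then have "card ?B = card (?r ` ?B)" by (simp add: card_image)
    also have "\<dots> \<le> C"
    proof (rule C)
      show "?r ` ?B \<subseteq> grid (I - {i}) (s ^ j)"
      proof (rule image_subsetI)
        fix b assume "b \<in> ?B"
        then have "b \<in> I \<rightarrow>\<^sub>E {..<s ^ j}" using W_grid by (auto simp: grid_def)
        then show "?r b \<in> grid (I - {i}) (s ^ j)"
          unfolding grid_def restrict_PiE_iff by (auto simp: PiE_iff)
      qed
      show "\<not> has_pattern g (I - {i}) P (?r ` ?B)"
        by (rule pattern_free_of_common_projection[OF assms(3) U(2,1) assms(2) free, where s = s])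
           (auto simp: proj_def)
    qed
    finally show ?thesis .
  qed
  have "card \<U> \<le> (\<Sum>v<s ^ j. card (Pow {v * s..<v * s + s}))"
    unfolding \<U>_def by (intro card_UN_le) auto
  then have card_\<U>: "card \<U> \<le> s ^ j * 2 ^ s" by (simp add: card_Pow)
  have "W = (\<Union>U\<in>\<U>. {b \<in> W. proj b = U})" using proj by blast
  then have "card W \<le> (\<Sum>U\<in>\<U>. card {b \<in> W. proj b = U})"
    using card_UN_le[OF fin_\<U>, of "\<lambda>U. {b \<in> W. proj b = U}"] by simp
  also have "\<dots> \<le> (\<Sum>U\<in>\<U>. C)" by (intro sum_mono fibre)
  also have "\<dots> \<le> s ^ j * 2 ^ s * C" using card_\<U> by simp
  finally show ?thesis unfolding W_def .
qed

text \<open>A block that is wide in some direction is charged its full volume \<open>s ^ card I\<close>, which is affordable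
since wide blocks are few. All other blocks have fewer than \<open>card P\<close> values in every
coordinate, hence few points.\<close>
lemma card_pattern_free_step:
  assumes "finite I" "finite P" "P \<noteq> {}" "0 < s"
    and A: "A \<subseteq> grid I (s ^ Suc j)" and free: "\<not> has_pattern g I P A"
    and C: "\<And>i B. i \<in> I \<Longrightarrow> B \<subseteq> grid (I - {i}) (s ^ j) \<Longrightarrow>
              \<not> has_pattern g (I - {i}) P B \<Longrightarrow> card B \<le> C"
  shows "card A \<le> card (coarsen I s ` A) * (card P - 1) ^ card I
                   + card I * (s ^ j * 2 ^ s * C) * s ^ card I"
proof -
  let ?W = "\<lambda>i. {b \<in> coarsen I s ` A. card P \<le> card ((\<lambda>a. a i) ` block I s A b)}"
  let ?A' = "coarsen I s ` A"
  let ?N = "?A' - (\<Union>i\<in>I. ?W i)"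
  have fin_A: "finite A" using A assms(1) finite_subset finite_grid by blast
  have narrow: "card (block I s A b) \<le> (card P - 1) ^ card I" if b: "b \<in> ?N" for b
  proof (rule card_le_of_projections[OF assms(1)])
    show "block I s A b \<subseteq> extensional I" using A by (auto simp: grid_def PiE_def)
    show "finite (block I s A b)" using fin_A by simp
    fix i assume "i \<in> I"
    then have "card ((\<lambda>a. a i) ` block I s A b) < card P" using b by (auto simp: not_le)
    then show "card ((\<lambda>a. a i) ` block I s A b) \<le> card P - 1" by linarith
  qed
  have "A = (\<Union>b\<in>?A'. block I s A b)" by blast
  then have "card A \<le> (\<Sum>b\<in>?A'. card (block I s A b))"
    using card_UN_le[of ?A' "block I s A"] fin_A by simp
  also have "\<dots> = (\<Sum>b\<in>?N. card (block I s A b)) + (\<Sum>b\<in>(\<Union>i\<in>I. ?W i). card (block I s A b))"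
    using fin_A by (intro sum.subset_diff) auto
  also have "\<dots> \<le> (\<Sum>b\<in>?N. (card P - 1) ^ card I) + (\<Sum>b\<in>(\<Union>i\<in>I. ?W i). s ^ card I)"
    by (intro add_mono sum_mono narrow card_block_le[OF assms(1) A assms(4)])
  also have "\<dots> = card ?N * (card P - 1) ^ card I + card (\<Union>i\<in>I. ?W i) * s ^ card I"
    by simp
  also have "\<dots> \<le> card ?A' * (card P - 1) ^ card I + card I * (s ^ j * 2 ^ s * C) * s ^ card I"
  proof (intro add_mono mult_right_mono)
    show "card ?N \<le> card ?A'" using fin_A by (intro card_mono) auto
    have "card (\<Union>i\<in>I. ?W i) \<le> (\<Sum>i\<in>I. card (?W i))" by (rule card_UN_le[OF assms(1)])
    also have "\<dots> \<le> (\<Sum>i\<in>I. s ^ j * 2 ^ s * C)"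
      using C by (intro sum_mono card_wide_blocks_le[OF assms(1) _ assms(2-4) A free]) auto
    finally show "card (\<Union>i\<in>I. ?W i) \<le> card I * (s ^ j * 2 ^ s * C)" by simp
  qed auto
  finally show ?thesis .
qed

text \<open>Dimension one: distinct points on a line are comparable, so \<open>card P\<close> of them already
contain every pattern on \<open>P\<close>.\<close>
lemma card_pattern_free_singleton:
  assumes "finite P" "A \<subseteq> grid {i} q" "\<not> has_pattern g {i} P A"
  shows "card A \<le> card P"
proof (rule ccontr)
  assume large: "\<not> card A \<le> card P"
  have ext: "a \<in> extensional {i}" if "a \<in> A" for a
    using assms(2) that by (auto simp: grid_def PiE_def)
  have "inj_on (\<lambda>a. a i) A"
    by (intro inj_onI extensionalityI[of _ "{i}"]) (auto intro: ext)
  then have "card P \<le> card ((\<lambda>a. a i) ` A)"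
    using large by (simp add: card_image)
  moreover have "finite A" using assms(2) finite_subset finite_grid[of "{i}"] by blast
  ultimately obtain t where t: "t ` P \<subseteq> (\<lambda>a. a i) ` A"
      "\<forall>x\<in>P. \<forall>y\<in>P. g i x < g i y \<longrightarrow> t x < t y"
    using strictly_monotone_choice[of P "(\<lambda>a. a i) ` A" "g i"] assms(1) by auto
  then have "\<forall>x\<in>P. \<exists>a\<in>A. t x = a i" by blast
  then obtain \<phi> where "\<forall>x\<in>P. \<phi> x \<in> A \<and> t x = \<phi> x i" by metis
  then have "has_pattern g {i} P A"
    using t(2) by (intro has_patternI[of _ \<phi>]) auto
  with assms(3) show False by simp
qed

text \<open>The Klazar--Marcus theorem, which extends the theorem of Marcus and Tardos on
permutation matrices to higher dimension. Coarsening bounds a pattern-free set by a smaller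
instance, up to the few wide blocks, which are controlled by dimension \<open>d - 1\<close>. The side is a power of the fixed base \<open>(card P)\<^sup>2\<close> so
that every coarsening is exact; one base serves all dimensions, which the induction on the
set of coordinates needs.\<close>
lemma pattern_free_bound:
  fixes g :: "'i \<Rightarrow> 'p \<Rightarrow> nat"
  assumes "finite I" "I \<noteq> {}" "finite P" "P \<noteq> {}"
  shows "\<exists>C. \<forall>j A. A \<subseteq> grid I (((card P)\<^sup>2) ^ j) \<longrightarrow> \<not> has_pattern g I P A \<longrightarrow>
           card A \<le> C * ((card P)\<^sup>2) ^ (j * (card I - 1))"
  using assms(1,2)
proof (induction I rule: finite_psubset_induct)
  case (psubset I)
  define k where "k = card P"
  define s where "s = k\<^sup>2"
  define d where "d = card I"
  have k: "0 < k" using assms by (auto simp: k_def card_gt_0_iff)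
  then have s: "0 < s" by (simp add: s_def)
  show ?case
  proof (cases "d = 1")
    case True
    then obtain i where i: "I = {i}" by (auto simp: d_def card_1_singleton_iff)
    show ?thesis
      by (rule exI[of _ k])
         (auto simp: i k_def intro: card_pattern_free_singleton[OF assms(3)])
  next
    case False
    moreover have "0 < d" using psubset by (auto simp: d_def card_gt_0_iff)
    ultimately have d: "2 \<le> d" by linarith
    have "\<forall>i\<in>I. \<exists>C. \<forall>j A. A \<subseteq> grid (I - {i}) (s ^ j) \<longrightarrow>
             \<not> has_pattern g (I - {i}) P A \<longrightarrow> card A \<le> C * s ^ (j * (d - 2))"
    proof
      fix i assume i: "i \<in> I"
      then have c: "card (I - {i}) = d - 1" using psubset by (simp add: d_def)
      then have "card (I - {i}) \<noteq> 0" using d by simp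
      then have ne: "I - {i} \<noteq> {}" by (metis card.empty)
      have sub: "I - {i} \<subset> I" using i by blast
      have e: "d - 1 - 1 = d - 2" by simp
      show "\<exists>C. \<forall>j A. A \<subseteq> grid (I - {i}) (s ^ j) \<longrightarrow>
             \<not> has_pattern g (I - {i}) P A \<longrightarrow> card A \<le> C * s ^ (j * (d - 2))"
        using psubset.IH[OF sub ne] by (simp only: s_def k_def c e)
    qed
    then obtain Cf where "\<forall>i\<in>I. \<forall>j A. A \<subseteq> grid (I - {i}) (s ^ j) \<longrightarrow>
             \<not> has_pattern g (I - {i}) P A \<longrightarrow> card A \<le> Cf i * s ^ (j * (d - 2))"
      by (rule bchoice[THEN exE])
    then have Cf: "card A \<le> Cf i * s ^ (j * (d - 2))"
      if "i \<in> I" "A \<subseteq> grid (I - {i}) (s ^ j)" "\<not> has_pattern g (I - {i}) P A" for i j A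
      using that by simp
    \<comment> \<open>The constant is one more than the total contribution of the wide blocks, so that it also covers
      the one-point grid.\<close>
    define D where "D = d * 2 ^ s * s ^ d * (\<Sum>i\<in>I. Cf i) + 1"
    have "card A \<le> D * s ^ (j * (d - 1))"
      if "A \<subseteq> grid I (s ^ j)" "\<not> has_pattern g I P A" for A j
      using that
    proof (induction j arbitrary: A)
      case 0
      have "card A \<le> card (grid I (s ^ 0))"
        using 0 psubset by (intro card_mono) auto
      also have "\<dots> = 1" using psubset by (simp add: card_grid)
      finally show ?case by (simp add: D_def)
    next
      case (Suc j)
      define q where "q = s ^ j"
      define S where "S = (\<Sum>i\<in>I. Cf i)"
      have pow: "s ^ (j * m) = q ^ m" for m by (simp add: q_def power_mult)
      have qd: "q * q ^ (d - 2) = q ^ (d - 1)"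
      proof -
        have "d - 1 = Suc (d - 2)" using d by simp
        then show ?thesis by simp
      qed
      have lower: "card B \<le> S * q ^ (d - 2)"
        if "i \<in> I" "B \<subseteq> grid (I - {i}) (s ^ j)" "\<not> has_pattern g (I - {i}) P B" for i B
      proof -
        have "Cf i \<le> S" unfolding S_def using psubset that by (intro member_le_sum) auto
        then show ?thesis using order_trans[OF Cf[OF that] mult_le_mono1] by (simp add: pow)
      qed
      have coarse: "card (coarsen I s ` A) \<le> D * q ^ (d - 1)"
        using Suc.IH[of "coarsen I s ` A"] Suc.prems coarsen_in_grid[of _ I s j]
          has_pattern_of_coarsen[of g I P s A] by (auto simp: pow)
      have "card A \<le> card (coarsen I s ` A) * (card P - 1) ^ card I
                   + card I * (s ^ j * 2 ^ s * (S * q ^ (d - 2))) * s ^ card I"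
        by (rule card_pattern_free_step[OF psubset.hyps(1) assms(3,4) s Suc.prems lower])
      also have "\<dots> = card (coarsen I s ` A) * (k - 1) ^ d
                   + d * 2 ^ s * s ^ d * S * (q * q ^ (d - 2))"
        by (simp add: k_def d_def q_def mult_ac)
      also have "\<dots> \<le> D * q ^ (d - 1) * (k - 1) ^ d + D * q ^ (d - 1)"
        unfolding qd by (intro add_mono mult_right_mono coarse) (simp_all add: D_def S_def)
      also have "\<dots> = D * q ^ (d - 1) * ((k - 1) ^ d + 1)" by (simp add: algebra_simps)
      also have "\<dots> \<le> D * q ^ (d - 1) * s ^ (d - 1)"
      proof (rule mult_left_mono)
        \<comment> \<open>This is where the base \<open>k\<^sup>2\<close> matters: as \<open>d \<le> 2 * (d - 1)\<close>, coarsening gains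
          more than the \<open>(k - 1) ^ d\<close> points that a narrow block can hold.\<close>
        have "(k - 1) ^ d < k ^ d" using k d by (intro power_strict_mono) auto
        also have "\<dots> \<le> k ^ (2 * (d - 1))" using k d by (intro power_increasing) auto
        finally show "(k - 1) ^ d + 1 \<le> s ^ (d - 1)" by (simp add: s_def power_mult)
      qed simp
      also have "\<dots> = D * s ^ (Suc j * (d - 1))"
        by (simp add: power_add pow[of "d - 1", simplified] mult_ac)
      finally show ?case .
    qed
    then have "\<forall>j A. A \<subseteq> grid I (s ^ j) \<longrightarrow> \<not> has_pattern g I P A \<longrightarrow> card A \<le> D * s ^ (j * (d - 1))"
      by simp
    then show ?thesis unfolding s_def k_def d_def by (rule exI)
  qed
qed

text \<open>A pattern-free set is determined by its coarsening \<open>A'\<close>, which is pattern-free, together with a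
subset of the union of the blocks indexed by \<open>A'\<close>. By the size bound there are few such blocks, so passing to the finer
grid multiplies the count by \<open>2\<close> to the order of \<open>s ^ (j * (d - 1))\<close>. For \<open>d \<ge> 2\<close> these exponents form
a geometric progression and their sum is dominated by the last one.\<close>
lemma count_pattern_free:
  fixes g :: "'i \<Rightarrow> 'p \<Rightarrow> nat"
  assumes "finite I" "2 \<le> card I" "finite P" "2 \<le> card P"
  shows "\<exists>K. \<forall>j. card {A. A \<subseteq> grid I (((card P)\<^sup>2) ^ j) \<and> \<not> has_pattern g I P A}
                   \<le> 2 ^ (K * ((card P)\<^sup>2) ^ (j * (card I - 1)))"
proof -
  define s where "s = (card P)\<^sup>2"
  define d where "d = card I"
  have s: "2 \<le> s" using assms(4) power_increasing[of 1 2 "card P"] by (simp add: s_def)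
  have "I \<noteq> {}" "P \<noteq> {}" using assms by auto
  then obtain C where C: "\<And>j A. A \<subseteq> grid I (s ^ j) \<Longrightarrow> \<not> has_pattern g I P A \<Longrightarrow>
        card A \<le> C * s ^ (j * (d - 1))"
    using pattern_free_bound[of I P g] assms by (auto simp: s_def d_def)
  define K where "K = C * s ^ d + 1"
  define Fr where "Fr j = {A. A \<subseteq> grid I (s ^ j) \<and> \<not> has_pattern g I P A}" for j
  have fin_Fr: "finite (Fr j)" for j
    unfolding Fr_def using assms(1) by (intro finite_subset[OF _ finite_Pow_iff[THEN iffD2, OF finite_grid]]) auto
  have "card (Fr j) \<le> 2 ^ (K * s ^ (j * (d - 1)))" for j
  proof (induction j)
    case 0
    have "card (Fr 0) \<le> card (Pow (grid I (s ^ 0)))"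
      using assms(1) by (intro card_mono) (auto simp: Fr_def)
    also have "\<dots> = 2" using assms(1) by (simp add: card_Pow card_grid)
    also have "\<dots> \<le> 2 ^ K" using power_increasing[of 1 K "2::nat"] by (simp add: K_def)
    finally show ?case by simp
  next
    case (Suc j)
    define q where "q = s ^ (j * (d - 1))"
    define M where "M = C * q * s ^ d"
    define c where "c = (\<lambda>A. coarsen I s ` A)"
    have c_Fr: "c A \<in> Fr j" if "A \<in> Fr (Suc j)" for A
      using that coarsen_in_grid[of _ I s j] has_pattern_of_coarsen[of g I P s A]
      by (auto simp: Fr_def c_def)
    have fibre: "card {A \<in> Fr (Suc j). c A = A'} \<le> 2 ^ M" if A': "A' \<in> Fr j" for A'
    proof -
      let ?G = "grid I (s ^ Suc j)"
      let ?L = "{a \<in> ?G. coarsen I s a \<in> A'}"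
      have fin: "finite ?G" using assms(1) by simp
      have finA': "finite A'" using A' assms(1) by (auto simp: Fr_def intro: finite_subset[OF _ finite_grid])
      have "?L = (\<Union>b\<in>A'. block I s ?G b)" by blast
      then have "card ?L \<le> (\<Sum>b\<in>A'. card (block I s ?G b))"
        using card_UN_le[OF finA', of "block I s ?G"] by simp
      also have "\<dots> \<le> (\<Sum>b\<in>A'. s ^ d)"
        unfolding d_def using s by (intro sum_mono card_block_le[OF assms(1) subset_refl]) auto
      also have "\<dots> \<le> M"
        using C[of A' j] A' by (simp add: M_def q_def Fr_def)
      finally have L: "card ?L \<le> M" .
      have "card {A \<in> Fr (Suc j). c A = A'} \<le> card (Pow ?L)"
        using fin by (intro card_mono) (auto simp: Fr_def c_def)
      also have "\<dots> = 2 ^ card ?L" using fin by (simp add: card_Pow)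
      also have "\<dots> \<le> 2 ^ M" using L by (intro power_increasing) auto
      finally show ?thesis .
    qed
    have "Fr (Suc j) = (\<Union>A'\<in>Fr j. {A \<in> Fr (Suc j). c A = A'})" using c_Fr by blast
    then have "card (Fr (Suc j)) \<le> (\<Sum>A'\<in>Fr j. card {A \<in> Fr (Suc j). c A = A'})"
      using card_UN_le[OF fin_Fr[of j], of "\<lambda>A'. {A \<in> Fr (Suc j). c A = A'}"] by simp
    also have "\<dots> \<le> (\<Sum>A'\<in>Fr j. 2 ^ M)" by (intro sum_mono fibre)
    also have "\<dots> = card (Fr j) * 2 ^ M" by simp
    also have "\<dots> \<le> 2 ^ (K * q) * 2 ^ M" using Suc.IH by (simp add: q_def)
    also have "\<dots> = 2 ^ (K * q + M)" by (simp add: power_add)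
    also have "\<dots> \<le> 2 ^ (K * s ^ (Suc j * (d - 1)))"
    proof (rule power_increasing)
      have "M \<le> K * q" by (simp add: M_def K_def algebra_simps)
      then have "K * q + M \<le> K * q * 2" by simp
      also have "\<dots> \<le> K * q * s ^ (d - 1)"
      proof (rule mult_left_mono)
        have "s ^ 1 \<le> s ^ (d - 1)" using s assms(2) by (intro power_increasing) (auto simp: d_def)
        then show "2 \<le> s ^ (d - 1)" using s by simp
      qed simp
      also have "\<dots> = K * s ^ (Suc j * (d - 1))" by (simp add: q_def power_add)
      finally show "K * q + M \<le> K * s ^ (Suc j * (d - 1))" .
    qed simp
    finally show ?case .
  qed
  then show ?thesis unfolding Fr_def s_def d_def by blast
qed

section \<open>Shearer's inequality and sets far from the middle\<close>
text \<open>For \<open>c j = a j + b j\<close> this is the superadditivity of the geometric mean (Mahler's inequality). After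
division by \<open>c\<close> and restriction to \<open>t\<close> indices of \<open>H\<close>, the inequality of arithmetic and geometric
means bounds \<open>x\<close> and \<open>y\<close> by the same quantity times the mean of \<open>a j / c j\<close> and of
\<open>b j / c j\<close>, and these two means sum to at most one. The factors of all other indices are at most one.\<close>
lemma superadditive_products:
  fixes a b c :: "'j \<Rightarrow> real"
  assumes "finite J" "H \<subseteq> J" "0 < t" "t \<le> card H" "0 \<le> x" "0 \<le> y"
    and a: "\<And>j. j \<in> J \<Longrightarrow> 0 \<le> a j \<and> a j \<le> c j"
    and b: "\<And>j. j \<in> J \<Longrightarrow> 0 \<le> b j \<and> b j \<le> c j"
    and ab: "\<And>j. j \<in> H \<Longrightarrow> a j + b j \<le> c j"
    and x: "x ^ t \<le> (\<Prod>j\<in>J. a j)" and y: "y ^ t \<le> (\<Prod>j\<in>J. b j)"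
  shows "(x + y) ^ t \<le> (\<Prod>j\<in>J. c j)"
proof (cases "\<exists>j\<in>J. c j = 0")
  case True
  then obtain j where j: "j \<in> J" "c j = 0" by blast
  then have "a j = 0" "b j = 0" using a[of j] b[of j] by auto
  then have "(\<Prod>j\<in>J. a j) = 0" "(\<Prod>j\<in>J. b j) = 0"
    using j(1) assms(1) by (auto intro: prod_zero)
  then have "x ^ t \<le> 0" "y ^ t \<le> 0" using x y by auto
  then have "x = 0" "y = 0"
    using assms(5,6) zero_less_power[of x t] zero_less_power[of y t] by linarith+
  moreover have "0 \<le> (\<Prod>j\<in>J. c j)" using a by (intro prod_nonneg) (metis order_trans)
  ultimately show ?thesis using assms(3) by (simp add: zero_power)
next
  case False
  then have c: "0 < c j" if "j \<in> J" for j using a[OF that] that by (metis order_le_less order_trans)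
  obtain H' where H': "H' \<subseteq> H" "card H' = t" using assms(4) by (metis obtain_subset_with_card_n)
  have "H' \<subseteq> J" using H'(1) assms(2) by (rule order_trans)
  then have finH: "finite H'" "H' \<subseteq> J" using assms(1) by (auto intro: finite_subset)
  have neH: "H' \<noteq> {}" using H' assms(3) by auto
  define R where "R = (\<Prod>j\<in>J. c j) powr (1 / t)"
  have R: "0 \<le> R" by (simp add: R_def)
  have step: "z \<le> R * (\<Sum>j\<in>H'. e j / c j / t)"
    if e: "\<And>j. j \<in> J \<Longrightarrow> 0 \<le> e j \<and> e j \<le> c j" and z: "0 \<le> z" "z ^ t \<le> (\<Prod>j\<in>J. e j)" for z e
  proof -
    have q: "0 \<le> e j / c j \<and> e j / c j \<le> 1" if "j \<in> J" for j
      using e[OF that] c[OF that] by simp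
    have "(\<Prod>j\<in>J. e j) = (\<Prod>j\<in>J. c j * (e j / c j))"
    proof (rule prod.cong[OF refl])
      fix j assume "j \<in> J"
      then show "e j = c j * (e j / c j)" using c[of j] by simp
    qed
    also have "\<dots> = (\<Prod>j\<in>J. c j) * (\<Prod>j\<in>J. e j / c j)" by (rule prod.distrib)
    also have "\<dots> = (\<Prod>j\<in>J. c j) * ((\<Prod>j\<in>J - H'. e j / c j) * (\<Prod>j\<in>H'. e j / c j))"
      using prod.subset_diff[OF finH(2) assms(1), of "\<lambda>j. e j / c j"] by simp
    also have "\<dots> \<le> (\<Prod>j\<in>J. c j) * (1 * (\<Prod>j\<in>H'. e j / c j))"
    proof (intro mult_left_mono mult_right_mono)
      show "(\<Prod>j\<in>J - H'. e j / c j) \<le> 1" using q by (intro prod_le_1) auto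
      show "0 \<le> (\<Prod>j\<in>H'. e j / c j)" using q finH by (intro prod_nonneg) auto
      show "0 \<le> (\<Prod>j\<in>J. c j)" using c by (intro prod_nonneg) (auto intro: less_imp_le)
    qed
    finally have le: "z ^ t \<le> (\<Prod>j\<in>J. c j) * (\<Prod>j\<in>H'. e j / c j)" using z(2) by simp
    have pos: "0 \<le> (\<Prod>j\<in>J. c j)" "0 \<le> (\<Prod>j\<in>H'. e j / c j)"
      using c q finH by (auto intro!: prod_nonneg intro: less_imp_le)
    have "z = (z ^ t) powr (1 / t)"
    proof (cases "z = 0")
      case True
      then show ?thesis using assms(3) by simp
    next
      case False
      then show ?thesis using z(1) assms(3) by (simp add: powr_powr flip: powr_realpow)
    qed
    also have "\<dots> \<le> ((\<Prod>j\<in>J. c j) * (\<Prod>j\<in>H'. e j / c j)) powr (1 / t)"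
      using le z(1) by (intro powr_mono2) auto
    also have "\<dots> = R * (\<Prod>j\<in>H'. e j / c j) powr (1 / card H')"
      using pos by (simp add: R_def powr_mult H')
    also have "\<dots> \<le> R * (\<Sum>j\<in>H'. e j / c j / card H')"
      using q finH by (intro mult_left_mono R arith_geom_mean[OF finH(1) neH]) auto
    finally show ?thesis by (simp add: H')
  qed
  have "x + y \<le> R * (\<Sum>j\<in>H'. a j / c j / t) + R * (\<Sum>j\<in>H'. b j / c j / t)"
    by (intro add_mono step a b x y assms)
  also have "\<dots> = R * (\<Sum>j\<in>H'. (a j + b j) / c j / t)"
    by (simp add: distrib_left sum.distrib add_divide_distrib)
  also have "\<dots> \<le> R * (\<Sum>j\<in>H'. 1 / t)"
  proof (intro mult_left_mono R sum_mono divide_right_mono)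
    fix j assume "j \<in> H'"
    then have "j \<in> H" "j \<in> J" using H' finH by auto
    then show "(a j + b j) / c j \<le> 1" using ab[of j] c[of j] by (simp add: divide_le_eq)
  qed simp
  also have "\<dots> = R" using H' assms(3) by simp
  finally have "(x + y) ^ t \<le> R ^ t" using assms by (intro power_mono) auto
  also have "R ^ t = (\<Prod>j\<in>J. c j)"
  proof -
    have "0 < (\<Prod>j\<in>J. c j)" using c by (intro prod_pos) auto
    then show ?thesis using assms(3) by (simp add: R_def powr_powr flip: powr_realpow)
  qed
  finally show ?thesis .
qed

text \<open>The counting form of Shearer's entropy inequality. The induction removes a point \<open>v\<close> and
splits the family according to whether \<open>v\<close> is a member; on a set \<open>S j\<close> containing \<open>v\<close> the traces of
the two halves stay apart, so that their numbers add up, and \<open>superadditive_products\<close> applies.\<close>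
lemma shearer_inequality:
  assumes "finite V" "finite J" "0 < t" "\<F> \<subseteq> Pow V"
    and "\<And>v. v \<in> V \<Longrightarrow> t \<le> card {j \<in> J. v \<in> S j}"
  shows "card \<F> ^ t \<le> (\<Prod>j\<in>J. card ((\<lambda>X. X \<inter> S j) ` \<F>))"
  using assms(1,4,5)
proof (induction V arbitrary: \<F> rule: finite_induct)
  case empty
  then have "\<F> = {} \<or> \<F> = {{}}" by auto
  then show ?case using assms(3) by (auto simp: zero_power)
next
  case (insert v V)
  define tr where "tr j \<G> = (\<lambda>X. X \<inter> S j) ` \<G>" for j and \<G> :: "'a set set"
  define F0 where "F0 = {X \<in> \<F>. v \<notin> X}"
  define F1 where "F1 = {X \<in> \<F>. v \<in> X}"
  define D1 where "D1 = (\<lambda>X. X - {v}) ` F1"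
  have fin: "finite \<F>" using insert.prems(1) insert.hyps(1) by (meson finite_Pow_iff finite_insert finite_subset)
  then have fins: "finite F0" "finite F1" "finite D1" by (auto simp: F0_def F1_def D1_def)
  have sub: "F0 \<subseteq> Pow V" "D1 \<subseteq> Pow V"
    using insert.prems(1) by (auto simp: F0_def F1_def D1_def)
  have "inj_on (\<lambda>X. X - {v}) F1" by (rule inj_onI) (auto simp: F1_def)
  then have "card D1 = card F1" by (simp add: D1_def card_image)
  moreover have "card \<F> = card F0 + card F1"
  proof -
    have "\<F> = F0 \<union> F1" "F0 \<inter> F1 = {}" by (auto simp: F0_def F1_def)
    then show ?thesis using fins card_Un_disjoint by metis
  qed
  ultimately have card_F: "card \<F> = card F0 + card D1" by simp
  have IH: "card \<G> ^ t \<le> (\<Prod>j\<in>J. card (tr j \<G>))" if "\<G> \<subseteq> Pow V" for \<G>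
    unfolding tr_def by (rule insert.IH[OF that]) (use insert.prems(2) in auto)
  have tr1: "tr j D1 = (\<lambda>Y. Y - {v}) ` tr j F1" for j
    unfolding tr_def D1_def image_image by (intro image_cong) auto
  have le0: "card (tr j F0) \<le> card (tr j \<F>)" for j
    using fin by (intro card_mono) (auto simp: tr_def F0_def)
  have le1: "card (tr j D1) \<le> card (tr j \<F>)" for j
  proof -
    have "card (tr j D1) \<le> card (tr j F1)"
      unfolding tr1 using fins by (intro card_image_le) (simp add: tr_def)
    also have "\<dots> \<le> card (tr j \<F>)" using fin by (intro card_mono) (auto simp: tr_def F1_def)
    finally show ?thesis .
  qed
  have le01: "card (tr j F0) + card (tr j D1) \<le> card (tr j \<F>)" if "v \<in> S j" for j
  proof -
    have "card (tr j D1) \<le> card (tr j F1)"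
      unfolding tr1 using fins by (intro card_image_le) (simp add: tr_def)
    moreover have "card (tr j F0 \<union> tr j F1) = card (tr j F0) + card (tr j F1)"
      using fins that by (intro card_Un_disjoint) (auto simp: tr_def F0_def F1_def)
    moreover have "card (tr j F0 \<union> tr j F1) \<le> card (tr j \<F>)"
      using fin by (intro card_mono) (auto simp: tr_def F0_def F1_def)
    ultimately show ?thesis by linarith
  qed
  have "(real (card F0) + real (card D1)) ^ t \<le> (\<Prod>j\<in>J. real (card (tr j \<F>)))"
  proof (rule superadditive_products[where H = "{j \<in> J. v \<in> S j}"
        and a = "\<lambda>j. real (card (tr j F0))" and b = "\<lambda>j. real (card (tr j D1))"])
    show "real (card F0) ^ t \<le> (\<Prod>j\<in>J. real (card (tr j F0)))"
      using IH[OF sub(1)] by (simp flip: of_nat_power of_nat_prod)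
    show "real (card D1) ^ t \<le> (\<Prod>j\<in>J. real (card (tr j D1)))"
      using IH[OF sub(2)] by (simp flip: of_nat_power of_nat_prod)
    show "real (card (tr j F0)) + real (card (tr j D1)) \<le> real (card (tr j \<F>))"
      if "j \<in> {j \<in> J. v \<in> S j}" for j
      using le01[of j] that by (simp flip: of_nat_add)
    show "t \<le> card {j \<in> J. v \<in> S j}" using insert.prems(2) by simp
  qed (use assms le0 le1 in auto)
  then have "real (card \<F> ^ t) \<le> real (\<Prod>j\<in>J. card (tr j \<F>))" by (simp add: card_F)
  then show ?case unfolding tr_def by (simp only: of_nat_le_iff)
qed

text \<open>The second moment of the size of a random subset. For each \<open>X\<close>, adding or not adding a new point moves
the deviation by one up or down, and \<open>(u - 1)\<^sup>2 + (u + 1)\<^sup>2 = 2 * u\<^sup>2 + 2\<close>.\<close>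
lemma sum_Pow_squared_deviation:
  assumes "finite A"
  shows "(\<Sum>X\<in>Pow A. (2 * int (card X) - int (card A))\<^sup>2) = int (card A) * 2 ^ card A"
  using assms
proof (induction A rule: finite_induct)
  case empty
  then show ?case by simp
next
  case (insert a A)
  let ?n = "int (card A)"
  let ?d = "\<lambda>X. 2 * int (card X) - ?n"
  have "inj_on (insert a) (Pow A)" using insert.hyps(2) by (auto simp: inj_on_def)
  moreover have "Pow A \<inter> insert a ` Pow A = {}" using insert.hyps(2) by auto
  ultimately have "(\<Sum>X\<in>Pow (insert a A). (2 * int (card X) - int (card (insert a A)))\<^sup>2)
      = (\<Sum>X\<in>Pow A. (2 * int (card X) - int (card (insert a A)))\<^sup>2)
      + (\<Sum>X\<in>Pow A. (2 * int (card (insert a X)) - int (card (insert a A)))\<^sup>2)"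
    using insert.hyps(1) by (simp add: Pow_insert sum.union_disjoint sum.reindex)
  also have "\<dots> = (\<Sum>X\<in>Pow A. (?d X - 1)\<^sup>2) + (\<Sum>X\<in>Pow A. (?d X + 1)\<^sup>2)"
  proof (intro arg_cong2[where f = "(+)"] sum.cong refl)
    fix X assume X: "X \<in> Pow A"
    show "(2 * int (card X) - int (card (insert a A)))\<^sup>2 = (?d X - 1)\<^sup>2"
      using insert.hyps by (simp add: algebra_simps)
    have "finite X" "a \<notin> X" using X insert.hyps finite_subset by auto
    then show "(2 * int (card (insert a X)) - int (card (insert a A)))\<^sup>2 = (?d X + 1)\<^sup>2"
      using insert.hyps by (simp add: algebra_simps)
  qed
  also have "\<dots> = (\<Sum>X\<in>Pow A. 2 * (?d X)\<^sup>2 + 2)"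
    by (simp add: power2_eq_square algebra_simps flip: sum.distrib)
  also have "\<dots> = 2 * (\<Sum>X\<in>Pow A. (?d X)\<^sup>2) + 2 * 2 ^ card A"
    using insert.hyps(1) by (simp add: sum.distrib sum_distrib_left card_Pow)
  also have "\<dots> = int (card (insert a A)) * 2 ^ card (insert a A)"
    using insert by (simp add: algebra_simps)
  finally show ?case .
qed

lemma two_power_le_central_binomial: "2 ^ n \<le> (n + 1) * (n choose (n div 2))"
proof -
  have "2 ^ n = (\<Sum>k\<le>n. n choose k)" by (simp add: choose_row_sum)
  also have "\<dots> \<le> (\<Sum>k\<le>n. n choose (n div 2))" by (intro sum_mono binomial_maximum)
  finally show ?thesis by simp
qed

text \<open>Chebyshev's inequality: a set far from the middle has squared deviation at least \<open>n\<^sup>2 / 4\<close>, so at most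
\<open>4 * 2 ^ n / n\<close> sets are far, and \<open>2 ^ n\<close> is at most \<open>n + 1\<close> times the central binomial coefficient.\<close>
lemma card_far_from_middle:
  assumes "finite A" "0 < card A"
  shows "card {X \<in> Pow A. 4 * card X < card A \<or> 3 * card A < 4 * card X}
           \<le> 8 * (card A choose (card A div 2))"
proof -
  define n where "n = card A"
  define F where "F = {X \<in> Pow A. 4 * card X < card A \<or> 3 * card A < 4 * card X}"
  have "int (card F) * (int n)\<^sup>2 = (\<Sum>X\<in>F. (int n)\<^sup>2)" by simp
  also have "\<dots> \<le> (\<Sum>X\<in>F. 4 * (2 * int (card X) - int n)\<^sup>2)"
  proof (rule sum_mono)
    fix X assume "X \<in> F"
    then have "int n \<le> \<bar>2 * (2 * int (card X) - int n)\<bar>" by (auto simp: F_def n_def)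
    then have "(int n)\<^sup>2 \<le> (2 * (2 * int (card X) - int n))\<^sup>2"
      by (metis abs_of_nat abs_le_square_iff)
    then show "(int n)\<^sup>2 \<le> 4 * (2 * int (card X) - int n)\<^sup>2"
      by (simp only: power_mult_distrib) simp
  qed
  also have "\<dots> \<le> (\<Sum>X\<in>Pow A. 4 * (2 * int (card X) - int n)\<^sup>2)"
    using assms(1) by (intro sum_mono2) (auto simp: F_def)
  also have "\<dots> = 4 * (int n * 2 ^ n)"
    using sum_Pow_squared_deviation[OF assms(1)] by (simp add: n_def flip: sum_distrib_left)
  finally have "int (card F * n * n) \<le> int (4 * 2 ^ n * n)"
    by (simp add: power2_eq_square mult_ac)
  then have "card F * n * n \<le> 4 * 2 ^ n * n" by (simp only: of_nat_le_iff)
  then have "card F * n \<le> 4 * 2 ^ n" using assms(2) by (simp add: n_def)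
  also have "\<dots> \<le> 4 * ((n + 1) * (n choose (n div 2)))"
    by (intro mult_left_mono two_power_le_central_binomial) simp
  also have "\<dots> \<le> 4 * ((2 * n) * (n choose (n div 2)))"
    using assms(2) by (intro mult_left_mono mult_right_mono) (auto simp: n_def)
  finally have "card F * n \<le> (8 * (n choose (n div 2))) * n" by (simp add: mult_ac)
  then show ?thesis using assms(2) by (simp add: F_def n_def)
qed

section \<open>Products of chains in the Boolean lattice\<close>
text \<open>To embed a grid into the Boolean lattice, the ground set is cut into \<open>card I\<close> consecutive blocks, the block of
\<open>i\<close> starting after \<open>e i * r\<close>, and \<open>a i\<close> says how long an initial segment of that block is taken; so
the sets obtained form a product of chains.\<close>
definition segments :: "('i \<Rightarrow> nat) \<Rightarrow> nat \<Rightarrow> 'i set \<Rightarrow> ('i \<Rightarrow> nat) \<Rightarrow> nat set" where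
  "segments e r I a = (\<Union>i\<in>I. {e i * r + 1..e i * r + a i})"

text \<open>All blocks have length \<open>r\<close> except the last one, which takes everything that is left. With \<open>r\<close> small
compared to \<open>n\<close>, the long block can compensate any choice of lengths in the others, so
that all levels near the middle meet the product of chains in many sets.\<close>
definition segment_lengths :: "('i \<Rightarrow> nat) \<Rightarrow> nat \<Rightarrow> nat \<Rightarrow> 'i set \<Rightarrow> ('i \<Rightarrow> nat) set" where
  "segment_lengths e r n I =
     (\<Pi>\<^sub>E i\<in>I. {..if Suc (e i) = card I then n - (card I - 1) * r else r})"

lemma segments_disjoint:
  assumes "\<And>i. i \<in> I \<Longrightarrow> e i < card I" "inj_on e I"
    and a: "a \<in> segment_lengths e r n I" and b: "b \<in> segment_lengths e r n I"
    and i: "i \<in> I" "u \<in> {e i * r + 1..e i * r + a i}"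
    and j: "j \<in> I" "u \<in> {e j * r + 1..e j * r + b j}"
  shows "i = j"
proof -
  have le: "c k \<le> r" if "c \<in> segment_lengths e r n I" "k \<in> I" "Suc (e k) \<noteq> card I" for c k
    using that by (auto simp: segment_lengths_def PiE_iff dest!: bspec split: if_splits)
  have *: False
    if "a \<in> segment_lengths e r n I" "i \<in> I" "j \<in> I" "e i < e j"
      "u \<le> e i * r + a i" "e j * r + 1 \<le> u" for a i j
  proof -
    have "a i \<le> r" using le[OF that(1,2)] that(4) assms(1)[OF that(3)] by simp
    moreover have "(e i + 1) * r \<le> e j * r" using that(4) by (intro mult_right_mono) auto
    ultimately show False using that(5,6) by simp
  qed
  have "e i = e j"
    using *[OF a i(1) j(1)] *[OF b j(1) i(1)] i(2) j(2) by (meson atLeastAtMost_iff linorder_neqE_nat)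
  then show ?thesis using assms(2) i(1) j(1) by (simp add: inj_on_eq_iff)
qed

lemma segments_subset_iff:
  assumes "\<And>i. i \<in> I \<Longrightarrow> e i < card I" "inj_on e I"
    and a: "a \<in> segment_lengths e r n I" and b: "b \<in> segment_lengths e r n I"
  shows "segments e r I a \<subseteq> segments e r I b \<longleftrightarrow> (\<forall>i\<in>I. a i \<le> b i)"
proof
  assume "\<forall>i\<in>I. a i \<le> b i"
  then show "segments e r I a \<subseteq> segments e r I b"
    unfolding segments_def by (intro UN_mono) auto
next
  assume sub: "segments e r I a \<subseteq> segments e r I b"
  show "\<forall>i\<in>I. a i \<le> b i"
  proof
    fix i assume i: "i \<in> I"
    show "a i \<le> b i"
    proof (cases "a i = 0")
      case False
      let ?u = "e i * r + a i"
      have u: "?u \<in> {e i * r + 1..e i * r + a i}" using False by simp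
      then have "?u \<in> segments e r I a" unfolding segments_def using i by (rule UN_I[rotated])
      then have "?u \<in> segments e r I b" using sub by blast
      then obtain j where j: "j \<in> I" "?u \<in> {e j * r + 1..e j * r + b j}"
        unfolding segments_def by (rule UN_E)
      then have "i = j" using segments_disjoint[OF assms i u] by simp
      then show ?thesis using j(2) by simp
    qed simp
  qed
qed

lemma card_segments:
  assumes "finite I" "\<And>i. i \<in> I \<Longrightarrow> e i < card I" "inj_on e I"
    and a: "a \<in> segment_lengths e r n I"
  shows "card (segments e r I a) = (\<Sum>i\<in>I. a i)"
proof -
  have "card (segments e r I a) = (\<Sum>i\<in>I. card {e i * r + 1..e i * r + a i})"
    unfolding segments_def
  proof (rule card_UN_disjoint)
    show "\<forall>i\<in>I. \<forall>j\<in>I. i \<noteq> j \<longrightarrow>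
        {e i * r + 1..e i * r + a i} \<inter> {e j * r + 1..e j * r + a j} = {}"
      using segments_disjoint[OF assms(2,3) a a] by (metis disjoint_iff)
  qed (use assms(1) in auto)
  then show ?thesis by simp
qed

lemma segments_in_Pow:
  assumes "\<And>i. i \<in> I \<Longrightarrow> e i < card I" "(card I - 1) * r \<le> n"
    and a: "a \<in> segment_lengths e r n I"
  shows "segments e r I a \<subseteq> {1..n}"
proof -
  have "e i * r + a i \<le> n" if i: "i \<in> I" for i
  proof (cases "Suc (e i) = card I")
    case True
    then have "a i \<le> n - (card I - 1) * r" "e i = card I - 1"
      using a i by (auto simp: segment_lengths_def PiE_iff dest!: bspec)
    then show ?thesis using assms(2) by simp
  next
    case False
    then have "a i \<le> r" using a i by (auto simp: segment_lengths_def PiE_iff dest!: bspec)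
    then have "e i * r + a i \<le> (e i + 1) * r" by simp
    also have "\<dots> \<le> (card I - 1) * r" using False assms(1)[OF i] by (intro mult_right_mono) auto
    finally show ?thesis using assms(2) by simp
  qed
  then show ?thesis by (fastforce simp: segments_def)
qed

text \<open>The lengths in the short blocks can be chosen freely, after which the last length is determined
by the prescribed sum; the two conditions on \<open>m\<close> say that it always fits.\<close>
lemma card_segment_lengths_ge:
  assumes "finite I" "bij_betw e I {..<card I}" "I \<noteq> {}"
    and m: "(card I - 1) * r \<le> m" "m + (card I - 1) * r \<le> n"
  shows "(r + 1) ^ (card I - 1) \<le> card {a \<in> segment_lengths e r n I. (\<Sum>i\<in>I. a i) = m}"
proof -
  have "card I - 1 \<in> {..<card I}" using assms(1,3) by (simp add: card_gt_0_iff)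
  then obtain i0 where i0: "i0 \<in> I" "e i0 = card I - 1"
    using assms(2) unfolding bij_betw_def by (metis imageE)
  have pos: "0 < card I" using assms(1,3) by (simp add: card_gt_0_iff)
  have other: "Suc (e i) \<noteq> card I" if "i \<in> I - {i0}" for i
  proof
    assume "Suc (e i) = card I"
    then have "e i = e i0" using i0 by simp
    then show False using that i0 assms(2) by (auto simp: bij_betw_def inj_on_def)
  qed
  let ?B = "\<Pi>\<^sub>E i\<in>I - {i0}. {..r}"
  let ?T = "{a \<in> segment_lengths e r n I. (\<Sum>i\<in>I. a i) = m}"
  define ext where "ext b = b(i0 := m - (\<Sum>i\<in>I - {i0}. b i))" for b :: "'a \<Rightarrow> nat"
  have "card ?B \<le> card ?T"
  proof (rule card_inj_on_le)
    show "inj_on ext ?B"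
    proof (rule inj_onI)
      fix b c assume bc: "b \<in> ?B" "c \<in> ?B" "ext b = ext c"
      show "b = c"
      proof (rule extensionalityI[of _ "I - {i0}"])
        show "b \<in> extensional (I - {i0})" "c \<in> extensional (I - {i0})"
          using bc by (auto simp: PiE_def)
        show "b i = c i" if "i \<in> I - {i0}" for i
          using fun_cong[OF bc(3), of i] that by (simp add: ext_def)
      qed
    qed
    show "ext ` ?B \<subseteq> ?T"
    proof (rule image_subsetI)
      fix b assume b: "b \<in> ?B"
      let ?s = "\<Sum>i\<in>I - {i0}. b i"
      have br: "b i \<le> r" if "i \<in> I - {i0}" for i using b that by (auto simp: PiE_iff)
      have "?s \<le> (\<Sum>i\<in>I - {i0}. r)" using br by (rule sum_mono)
      then have s: "?s \<le> m" using m(1) assms(1) i0 by simp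
      have "(\<Sum>i\<in>I. ext b i) = ext b i0 + (\<Sum>i\<in>I - {i0}. ext b i)"
        by (rule sum.remove[OF assms(1) i0(1)])
      also have "(\<Sum>i\<in>I - {i0}. ext b i) = ?s" by (intro sum.cong) (auto simp: ext_def)
      finally have sum: "(\<Sum>i\<in>I. ext b i) = m" using s by (simp add: ext_def)
      have "ext b i \<le> (if Suc (e i) = card I then n - (card I - 1) * r else r)" if "i \<in> I" for i
      proof (cases "i = i0")
        case True
        then show ?thesis using i0 pos m(2) by (simp add: ext_def)
      next
        case False
        then show ?thesis using br[of i] other[of i] that by (simp add: ext_def)
      qed
      moreover have "ext b \<in> extensional I"
        using b i0 by (auto simp: ext_def PiE_def extensional_def)
      ultimately have "ext b \<in> segment_lengths e r n I"
        by (auto simp: segment_lengths_def PiE_iff)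
      with sum show "ext b \<in> ?T" by simp
    qed
    show "finite ?T"
      using assms(1) by (simp add: segment_lengths_def finite_PiE)
  qed
  moreover have "card ?B = (r + 1) ^ (card I - 1)"
    using assms(1) i0 by (simp add: card_PiE)
  ultimately show ?thesis by simp
qed

lemma ex_permutes_image_eq:
  assumes "finite A" "X \<subseteq> A" "Y \<subseteq> A" "card X = card Y"
  shows "\<exists>\<tau>. \<tau> permutes A \<and> \<tau> ` X = Y"
proof -
  have fin: "finite X" "finite Y" using assms finite_subset by auto
  obtain f where f: "bij_betw f X Y"
    using fin assms(4) by (metis finite_same_card_bij)
  have "card (A - X) = card (A - Y)" using assms fin by (simp add: card_Diff_subset)
  then obtain h where h: "bij_betw h (A - X) (A - Y)"
    using assms(1) by (metis finite_Diff finite_same_card_bij)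
  define \<tau> where "\<tau> x = (if x \<in> X then f x else if x \<in> A then h x else x)" for x
  have fX: "bij_betw \<tau> X Y" using f by (rule bij_betw_cong[THEN iffD1, rotated]) (simp add: \<tau>_def)
  have "bij_betw \<tau> (A - X) (A - Y)"
    using h by (rule bij_betw_cong[THEN iffD1, rotated]) (simp add: \<tau>_def)
  then have "bij_betw \<tau> (X \<union> (A - X)) (Y \<union> (A - Y))"
    by (intro bij_betw_combine fX) auto
  then have "bij_betw \<tau> A A" using assms by (simp add: Un_absorb1)
  then have "\<tau> permutes A" by (rule bij_imp_permutes) (use assms in \<open>auto simp: \<tau>_def\<close>)
  then show ?thesis using fX by (auto simp: bij_betw_def)
qed

text \<open>Double counting of the pairs of a permutation \<open>\<sigma>\<close> and a set of size \<open>card X\<close> in the image of \<open>\<G>\<close> under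
\<open>\<sigma>\<close>. By symmetry each set of this size is covered by equally many permutations, and each
permutation covers as many of them as \<open>\<G>\<close> contains.\<close>
lemma card_permutations_covering:
  assumes A: "finite A" and \<G>: "\<G> \<subseteq> Pow A" and X: "X \<subseteq> A"
  shows "card {\<sigma>. \<sigma> permutes A \<and> X \<in> (`) \<sigma> ` \<G>} * (card A choose card X)
       = card {\<sigma>. \<sigma> permutes A} * card {Y \<in> \<G>. card Y = card X}"
proof -
  define perms where "perms = {\<sigma>. \<sigma> permutes A}"
  define L where "L = {Y. Y \<subseteq> A \<and> card Y = card X}"
  define c where "c Y = card {\<sigma> \<in> perms. Y \<in> (`) \<sigma> ` \<G>}" for Y
  have fin: "finite perms" "finite L" using A by (auto simp: perms_def L_def finite_permutations)
  have c_le: "c Y \<le> c Z" if YZ: "Y \<in> L" "Z \<in> L" for Y Z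
  proof -
    obtain \<tau> where \<tau>: "\<tau> permutes A" "\<tau> ` Y = Z"
      using ex_permutes_image_eq[OF A, of Y Z] YZ by (auto simp: L_def)
    show ?thesis unfolding c_def
    proof (rule card_inj_on_le)
      show "inj_on ((\<circ>) \<tau>) {\<sigma> \<in> perms. Y \<in> (`) \<sigma> ` \<G>}"
        using permutes_inj[OF \<tau>(1)] by (auto simp: inj_on_def fun_eq_iff dest: injD)
      show "(\<circ>) \<tau> ` {\<sigma> \<in> perms. Y \<in> (`) \<sigma> ` \<G>} \<subseteq> {\<sigma> \<in> perms. Z \<in> (`) \<sigma> ` \<G>}"
      proof (rule image_subsetI)
        fix \<sigma> assume "\<sigma> \<in> {\<sigma> \<in> perms. Y \<in> (`) \<sigma> ` \<G>}"
        then obtain W where W: "\<sigma> permutes A" "W \<in> \<G>" "Y = \<sigma> ` W" by (auto simp: perms_def)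
        have "Z = (\<tau> \<circ> \<sigma>) ` W" using W(3) \<tau>(2) by (simp add: image_comp)
        then show "\<tau> \<circ> \<sigma> \<in> {\<sigma> \<in> perms. Z \<in> (`) \<sigma> ` \<G>}"
          using W(2) permutes_compose[OF W(1) \<tau>(1)] by (auto simp: perms_def)
      qed
      show "finite {\<sigma> \<in> perms. Z \<in> (`) \<sigma> ` \<G>}" using fin by simp
    qed
  qed
  have XL: "X \<in> L" using X by (simp add: L_def)
  have level: "card {Y \<in> L. Y \<in> (`) \<sigma> ` \<G>} = card {Y \<in> \<G>. card Y = card X}" if "\<sigma> \<in> perms" for \<sigma>
  proof -
    have \<sigma>: "\<sigma> permutes A" using that by (simp add: perms_def)
    then have inj: "inj \<sigma>" by (rule permutes_inj)
    have card: "card (\<sigma> ` Y) = card Y" for Y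
      using inj by (metis card_image inj_on_subset subset_UNIV)
    have "{Y \<in> L. Y \<in> (`) \<sigma> ` \<G>} = (`) \<sigma> ` {Y \<in> \<G>. card Y = card X}"
      using \<G> permutes_image[OF \<sigma>] by (auto simp: L_def card)
    moreover have "inj_on ((`) \<sigma>) {Y \<in> \<G>. card Y = card X}"
      using inj by (auto simp: inj_on_def inj_image_eq_iff)
    ultimately show ?thesis by (simp add: card_image)
  qed
  have "c X * card L = (\<Sum>Y\<in>L. c X)" by simp
  also have "\<dots> = (\<Sum>Y\<in>L. c Y)" using c_le XL by (intro sum.cong) (auto intro: antisym)
  also have "\<dots> = (\<Sum>\<sigma>\<in>perms. card {Y \<in> L. Y \<in> (`) \<sigma> ` \<G>})"
    unfolding c_def using fin by (intro sum_multicount_gen) auto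
  also have "\<dots> = card perms * card {Y \<in> \<G>. card Y = card X}" using level by simp
  finally show ?thesis using n_subsets[OF A, of "card X"] by (simp add: c_def L_def perms_def)
qed

text \<open>A finite poset is an induced subposet of a grid with one coordinate for each element \<open>i\<close>. The
number \<open>h x\<close> of elements below \<open>x\<close> is strictly monotone, and it remains so if the elements above \<open>i\<close>
are raised over all others. When \<open>x\<close> is not below \<open>y\<close>, coordinate \<open>x\<close> raises \<open>x\<close> but not \<open>y\<close>.\<close>
lemma ex_realizer:
  fixes P :: "'a::order set"
  assumes "finite P"
  shows "\<exists>g::'a \<Rightarrow> 'a \<Rightarrow> nat. (\<forall>i\<in>P. \<forall>x\<in>P. \<forall>y\<in>P. x < y \<longrightarrow> g i x < g i y) \<and>
           (\<forall>x\<in>P. \<forall>y\<in>P. \<not> x \<le> y \<longrightarrow> (\<exists>i\<in>P. g i y < g i x))"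
proof -
  define h where "h x = card {z \<in> P. z \<le> x}" for x
  define g where "g i x = (if i \<le> x then card P else 0) + h x" for i x
  have h: "h x < h y" if "x \<in> P" "y \<in> P" "x < y" for x y
    unfolding h_def
  proof (rule psubset_card_mono)
    have "{z \<in> P. z \<le> x} \<subseteq> {z \<in> P. z \<le> y}" using that(3) by auto
    moreover have "y \<in> {z \<in> P. z \<le> y}" "y \<notin> {z \<in> P. z \<le> x}" using that by auto
    ultimately show "{z \<in> P. z \<le> x} \<subset> {z \<in> P. z \<le> y}" by blast
  qed (use assms in auto)
  have "g i x < g i y" if "x \<in> P" "y \<in> P" "x < y" for i x y
    using h[OF that] that(3) by (auto simp: g_def)
  moreover have "g x y < g x x" if "x \<in> P" "y \<in> P" "\<not> x \<le> y" for x y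
  proof -
    have "0 < h x" unfolding h_def using assms that by (auto simp: card_gt_0_iff)
    moreover have "h y \<le> card P" unfolding h_def using assms by (intro card_mono) auto
    ultimately show ?thesis using that(3) by (simp add: g_def)
  qed
  ultimately show ?thesis by blast
qed

text \<open>A pattern in a grid is a copy of \<open>P\<close> in the Boolean lattice as soon as \<open>T\<close> carries the product order
to inclusion: comparable elements are strictly ordered in every coordinate, and
if \<open>x\<close> is not below \<open>y\<close>, some coordinate witnesses it.\<close>
lemma induced_copy_of_pattern:
  fixes P :: "'a::order set" and T :: "('i \<Rightarrow> nat) \<Rightarrow> 'b set"
  assumes "has_pattern g I P A"
    and lt: "\<And>i x y. i \<in> I \<Longrightarrow> x \<in> P \<Longrightarrow> y \<in> P \<Longrightarrow> x < y \<Longrightarrow> g i x < g i y"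
    and nle: "\<And>x y. x \<in> P \<Longrightarrow> y \<in> P \<Longrightarrow> \<not> x \<le> y \<Longrightarrow> \<exists>i\<in>I. g i y < g i x"
    and T: "\<And>a b. a \<in> A \<Longrightarrow> b \<in> A \<Longrightarrow> T a \<subseteq> T b \<longleftrightarrow> (\<forall>i\<in>I. a i \<le> b i)"
  shows "contains_induced_copy (T ` A) P"
proof -
  from assms(1) obtain \<phi> where \<phi>A: "\<And>x. x \<in> P \<Longrightarrow> \<phi> x \<in> A"
    and \<phi>: "\<And>i x y. i \<in> I \<Longrightarrow> x \<in> P \<Longrightarrow> y \<in> P \<Longrightarrow> g i x < g i y \<Longrightarrow> \<phi> x i < \<phi> y i"
    by (elim has_patternE) metis
  define f where "f x = T (\<phi> x)" for x
  have f: "f x \<subseteq> f y \<longleftrightarrow> x \<le> y" if xy: "x \<in> P" "y \<in> P" for x y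
  proof
    assume "x \<le> y"
    then consider "x = y" | "x < y" by (auto simp: order_le_less)
    then show "f x \<subseteq> f y"
    proof cases
      case 2
      then have "\<phi> x i \<le> \<phi> y i" if "i \<in> I" for i
        using \<phi>[OF that \<open>x \<in> P\<close> \<open>y \<in> P\<close>] lt[OF that \<open>x \<in> P\<close> \<open>y \<in> P\<close>] by simp
      then show ?thesis using T \<phi>A xy by (simp add: f_def)
    qed simp
  next
    assume sub: "f x \<subseteq> f y"
    show "x \<le> y"
    proof (rule ccontr)
      assume "\<not> x \<le> y"
      then obtain i where i: "i \<in> I" "g i y < g i x" using nle[OF xy] by blast
      then have "\<phi> y i < \<phi> x i" using \<phi>[OF i(1) xy(2,1)] by blast
      moreover have "\<phi> x i \<le> \<phi> y i" using sub T \<phi>A xy i by (simp add: f_def)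
      ultimately show False by simp
    qed
  qed
  show ?thesis unfolding contains_induced_copy_def
  proof (intro exI[of _ f] conjI ballI)
    show "inj_on f P"
      by (rule inj_onI) (metis f order_antisym order_refl)
    show "f ` P \<subseteq> T ` A" using \<phi>A by (auto simp: f_def)
    show "f x < f y \<longleftrightarrow> x < y" if "x \<in> P" "y \<in> P" for x y
      using f[OF that] f[OF that(2,1)] by (simp add: less_le_not_le)
  qed
qed

lemma contains_induced_copy_mono:
  "contains_induced_copy Q P \<Longrightarrow> Q \<subseteq> Q' \<Longrightarrow> contains_induced_copy Q' P"
  unfolding contains_induced_copy_def by (metis subset_trans)

lemma finite_induced_free_families: "finite (induced_free_families n P)"
  by (rule finite_subset[of _ "Pow (Pow {1..n})"]) (auto simp: induced_free_families_def)

text \<open>The middle level is an antichain, whereas a copy of \<open>P\<close> would bring two comparable sets with it.\<close>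
lemma middle_binomial_le_La_star:
  fixes P :: "'a::order set"
  assumes "\<not> is_antichain P"
  shows "n choose (n div 2) \<le> La_star n P"
proof -
  let ?M = "{X. X \<subseteq> {1..n} \<and> card X = n div 2}"
  have "\<not> contains_induced_copy ?M P"
  proof
    assume "contains_induced_copy ?M P"
    then obtain f where f: "f ` P \<subseteq> ?M" "\<And>x y. x \<in> P \<Longrightarrow> y \<in> P \<Longrightarrow> f x < f y \<longleftrightarrow> x < y"
      unfolding contains_induced_copy_def by (elim exE conjE) simp
    obtain x y where xy: "x \<in> P" "y \<in> P" "x < y" using assms by (auto simp: is_antichain_def)
    then have "f x \<subset> f y" "f x \<in> ?M" "f y \<in> ?M" using f by auto
    moreover then have "finite (f y)" using finite_subset[of "f y" "{1..n}"] by simp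
    ultimately show False using psubset_card_mono[of "f y" "f x"] by simp
  qed
  then have "?M \<in> induced_free_families n P" by (auto simp: induced_free_families_def)
  then have "card ?M \<le> La_star n P"
    unfolding La_star_def using finite_induced_free_families[of n P] by (intro Max_ge) auto
  then show ?thesis using n_subsets[of "{1..n}" "n div 2"] by simp
qed

section \<open>Counting induced \<open>P\<close>-free families\<close>
lemma power_bracket:
  fixes s n :: nat
  assumes "2 \<le> s" "1 \<le> n"
  obtains j where "n < s ^ j" "s ^ j \<le> s * n"
proof -
  define j where "j = (LEAST j. n < s ^ j)"
  have "n < s ^ n" using assms(1) by (meson less_exp order_less_le_trans power_mono zero_le)
  then have j: "n < s ^ j" unfolding j_def by (rule LeastI)
  have "j \<noteq> 0" using j assms(2) by (cases j) auto
  then obtain i where i: "j = Suc i" by (cases j) auto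
  have "\<not> n < s ^ i" by (rule not_less_Least) (simp add: i flip: j_def)
  then have "s ^ j \<le> s * n" using i by simp
  with j show thesis by (rule that)
qed

text \<open>The main estimate, for families that stay near the middle of the lattice. The images of one product of
\<open>d = card P\<close> chains under all permutations of the ground set form a cover. Each trace is a pattern-free
subset of a \<open>d\<close>-dimensional grid of side of order \<open>n\<close>, so there are \<open>2\<close> to the order of \<open>n ^ (d - 1)\<close>
traces. Each set \<open>X\<close> is covered by a proportion of the permutations that is at least of order
\<open>n ^ (d - 1)\<close> divided by the central binomial coefficient. In Shearer's inequality the powers of
\<open>n\<close> cancel.\<close>
lemma middle_families_bound:
  fixes P :: "'a::order set"
  assumes "finite P" "2 \<le> card P"
  shows "\<exists>K. \<forall>n\<ge>1. card {F \<in> induced_free_families n P. \<forall>X\<in>F. n \<le> 4 * card X \<and> 4 * card X \<le> 3 * n}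
                     \<le> 2 ^ (K * (n choose (n div 2)))"
proof -
  define d where "d = card P"
  define s where "s = d\<^sup>2"
  have d: "2 \<le> d" using assms(2) by (simp add: d_def)
  have s: "2 \<le> s" using d power_increasing[of 1 2 d] by (simp add: s_def)
  obtain g :: "'a \<Rightarrow> 'a \<Rightarrow> nat"
    where g: "\<forall>i\<in>P. \<forall>x\<in>P. \<forall>y\<in>P. x < y \<longrightarrow> g i x < g i y"
      "\<forall>x\<in>P. \<forall>y\<in>P. \<not> x \<le> y \<longrightarrow> (\<exists>i\<in>P. g i y < g i x)"
    using ex_realizer[OF assms(1)] by (elim exE conjE)
  have lt: "g i x < g i y" if "i \<in> P" "x \<in> P" "y \<in> P" "x < y" for i x y
    using g(1) that by simp
  have nle: "\<exists>i\<in>P. g i y < g i x" if "x \<in> P" "y \<in> P" "\<not> x \<le> y" for x y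
    using g(2) that by simp
  obtain K where K: "\<forall>j. card {A. A \<subseteq> grid P (s ^ j) \<and> \<not> has_pattern g P P A} \<le> 2 ^ (K * s ^ (j * (d - 1)))"
    using count_pattern_free[OF assms assms, of g] unfolding s_def d_def by (elim exE)
  obtain e where e: "bij_betw e P {..<d}"
    using ex_bij_betw_finite_nat[OF assms(1)] by (auto simp: d_def lessThan_atLeast0)
  have e_less: "\<And>i. i \<in> P \<Longrightarrow> e i < card P" and e_inj: "inj_on e P"
    using e by (auto simp: bij_betw_def d_def)
  define K' where "K' = K * (4 * s * d) ^ (d - 1)"
  have "card {F \<in> induced_free_families n P. \<forall>X\<in>F. n \<le> 4 * card X \<and> 4 * card X \<le> 3 * n}
          \<le> 2 ^ (K' * (n choose (n div 2)))" if n: "1 \<le> n" for n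
  proof -
    \<comment> \<open>The \<open>d - 1\<close> short blocks together take at most a quarter of the ground set, so every size between
      \<open>n / 4\<close> and \<open>3 * n / 4\<close> can be completed in the last block.\<close>
    define r where "r = n div (4 * d)"
    define R where "R = (r + 1) ^ (d - 1)"
    define B where "B = n choose (n div 2)"
    define V where "V = {X \<in> Pow {1..n}. n \<le> 4 * card X \<and> 4 * card X \<le> 3 * n}"
    define \<F> where "\<F> = {F \<in> induced_free_families n P. \<forall>X\<in>F. n \<le> 4 * card X \<and> 4 * card X \<le> 3 * n}"
    define box where "box = segment_lengths e r n P"
    define \<G> where "\<G> = segments e r P ` box"
    define perms where "perms = {\<sigma>. \<sigma> permutes {1..n}}"
    define S where "S \<sigma> = (`) \<sigma> ` \<G>" for \<sigma> :: "nat \<Rightarrow> nat"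
    define c where "c X = card {\<sigma> \<in> perms. X \<in> S \<sigma>}" for X
    have B: "0 < B" by (simp add: B_def)
    have fin_perms: "finite perms" and perms: "0 < card perms"
    proof -
      show "finite perms" by (simp add: perms_def finite_permutations)
      moreover have "id \<in> perms" by (simp add: perms_def permutes_id)
      ultimately show "0 < card perms" by (auto simp: card_gt_0_iff)
    qed
    have four_r: "4 * ((d - 1) * r) \<le> n"
    proof -
      have "4 * ((d - 1) * r) \<le> 4 * (d * r)" by (intro mult_left_mono mult_right_mono) auto
      also have "\<dots> \<le> n" using times_div_less_eq_dividend[of "4 * d" n] by (simp add: r_def mult.assoc)
      finally show ?thesis .
    qed
    have seg_iff: "segments e r P a \<subseteq> segments e r P b \<longleftrightarrow> (\<forall>i\<in>P. a i \<le> b i)"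
      if "a \<in> box" "b \<in> box" for a b
      using segments_subset_iff[OF e_less e_inj] that by (simp add: box_def)
    have seg_inj: "inj_on (segments e r P) box"
    proof (rule inj_onI)
      fix a b assume ab: "a \<in> box" "b \<in> box" "segments e r P a = segments e r P b"
      have "a i = b i" if "i \<in> P" for i
        using seg_iff[OF ab(1,2)] seg_iff[OF ab(2,1)] ab(3) that by (auto intro: antisym)
      then show "a = b" using ab(1,2)
        by (intro extensionalityI[of a P b]) (auto simp: box_def segment_lengths_def PiE_def)
    qed
    have fin_box: "finite box"
      using assms(1) by (simp add: box_def segment_lengths_def finite_PiE)
    have \<G>: "\<G> \<subseteq> Pow {1..n}"
    proof -
      have "segments e r P a \<subseteq> {1..n}" if "a \<in> box" for a
        by (rule segments_in_Pow[where e = e and I = P])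
           (use e_less four_r that in \<open>auto simp: box_def d_def\<close>)
      then show ?thesis by (auto simp only: \<G>_def)
    qed
    have coverage: "card perms * R \<le> c X * B" if X: "X \<in> V" for X
    proof -
      have m: "(card P - 1) * r \<le> card X" "card X + (card P - 1) * r \<le> n"
        using X four_r by (auto simp: V_def d_def)
      have "{Y \<in> \<G>. card Y = card X} = segments e r P ` {a \<in> box. (\<Sum>i\<in>P. a i) = card X}"
        using card_segments[OF assms(1) e_less e_inj] by (auto simp: \<G>_def box_def)
      then have "card {Y \<in> \<G>. card Y = card X} = card {a \<in> box. (\<Sum>i\<in>P. a i) = card X}"
        using inj_on_subset[OF seg_inj] by (simp add: card_image)
      also have "\<dots> \<ge> R"
        unfolding R_def box_def d_def
        using e assms by (intro card_segment_lengths_ge m) (auto simp: d_def)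
      finally have "card perms * R \<le> card perms * card {Y \<in> \<G>. card Y = card X}" by simp
      also have "\<dots> = c X * (n choose card X)"
        using card_permutations_covering[OF _ \<G>, of X] X by (simp add: c_def perms_def S_def V_def)
      also have "\<dots> \<le> c X * B" unfolding B_def by (intro mult_left_mono binomial_maximum) simp
      finally show ?thesis .
    qed
    have R: "0 < R" by (simp add: R_def)
    have fin_V: "finite V" by (simp add: V_def)
    \<comment> \<open>The covering multiplicity used in Shearer's inequality. For \<open>n = 1\<close> no set is near the middle and
      there is no minimum to take; any positive value that satisfies the third condition will do.\<close>
    obtain t where t: "0 < t" "\<And>X. X \<in> V \<Longrightarrow> t \<le> c X" "card perms * R \<le> t * B"
    proof (cases "V = {}")
      case True
      show thesis by (rule that[of "card perms * R"]) (use True perms R B in auto)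
    next
      case False
      then have "Min (c ` V) \<in> c ` V" using fin_V by (intro Min_in) auto
      then obtain X where X: "X \<in> V" "Min (c ` V) = c X" by blast
      have "0 < card perms * R" using perms R by simp
      then have "0 < c X" using coverage[OF X(1)] by (cases "c X") auto
      moreover have "c X \<le> c Y" if "Y \<in> V" for Y
        using that fin_V by (simp flip: X(2))
      ultimately show thesis using that[of "c X"] coverage[OF X(1)] by blast
    qed
    obtain j where j: "n + 1 \<le> s ^ j" "s ^ j \<le> s * (n + 1)"
      using power_bracket[OF s, of "n + 1"] by (metis le_add2 less_imp_le)
    define E where "E = K * s ^ (j * (d - 1))"
    have E: "E \<le> K' * R"
    proof -
      have "n < 4 * d * (r + 1)"
        using dividend_less_times_div[of "4 * d" n] d by (simp add: r_def algebra_simps)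
      then have "n + 1 \<le> 4 * d * (r + 1)" by simp
      then have "s * (n + 1) \<le> s * (4 * d * (r + 1))" by (rule mult_left_mono) simp
      then have "s ^ j \<le> 4 * s * d * (r + 1)" using j(2) by (simp add: mult_ac)
      then have "(s ^ j) ^ (d - 1) \<le> (4 * s * d * (r + 1)) ^ (d - 1)" by (rule power_mono) simp
      then have "s ^ (j * (d - 1)) \<le> (4 * s * d) ^ (d - 1) * R"
        by (simp only: R_def power_mult power_mult_distrib)
      then have "K * s ^ (j * (d - 1)) \<le> K * ((4 * s * d) ^ (d - 1) * R)" by (rule mult_left_mono) simp
      then show ?thesis by (simp add: E_def K'_def mult.assoc)
    qed
    have box_grid: "box \<subseteq> grid P (s ^ j)"
    proof
      fix a assume a: "a \<in> box"
      have "a i < s ^ j" if "i \<in> P" for i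
      proof -
        have "a i \<le> max (n - (card P - 1) * r) r"
          using a that by (auto simp: box_def segment_lengths_def PiE_iff dest!: bspec split: if_splits)
        also have "\<dots> \<le> n" by (simp add: r_def)
        finally show ?thesis using j(1) by simp
      qed
      then show "a \<in> grid P (s ^ j)"
        using a by (auto simp: grid_def box_def segment_lengths_def PiE_iff)
    qed
    have trace: "card ((\<lambda>F. F \<inter> S \<sigma>) ` \<F>) \<le> 2 ^ E" if \<sigma>: "\<sigma> \<in> perms" for \<sigma>
    proof -
      have inj: "inj \<sigma>" using \<sigma> permutes_inj by (auto simp: perms_def)
      define T where "T a = \<sigma> ` segments e r P a" for a
      have T: "T a \<subseteq> T b \<longleftrightarrow> (\<forall>i\<in>P. a i \<le> b i)" if "a \<in> box" "b \<in> box" for a b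
        using seg_iff[OF that] inj by (simp add: T_def inj_image_subset_iff)
      let ?Fr = "{A. A \<subseteq> grid P (s ^ j) \<and> \<not> has_pattern g P P A}"
      have fin: "finite ?Fr"
        by (rule finite_subset[of _ "Pow (grid P (s ^ j))"]) (use assms(1) in auto)
      have "(\<lambda>F. F \<inter> S \<sigma>) ` \<F> \<subseteq> (\<lambda>A. T ` A) ` ?Fr"
      proof (rule image_subsetI)
        fix F assume F: "F \<in> \<F>"
        define A where "A = {a \<in> box. T a \<in> F}"
        have "F \<inter> S \<sigma> = T ` A" by (auto simp: S_def \<G>_def A_def T_def)
        moreover have "\<not> has_pattern g P P A"
        proof
          assume "has_pattern g P P A"
          then have "contains_induced_copy (T ` A) P"
            by (rule induced_copy_of_pattern[OF _ lt nle]) (auto simp: A_def T)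
          then have "contains_induced_copy F P"
            by (rule contains_induced_copy_mono) (auto simp: A_def)
          then show False using F by (simp add: \<F>_def induced_free_families_def)
        qed
        moreover have "A \<subseteq> grid P (s ^ j)" using box_grid by (auto simp: A_def)
        ultimately show "F \<inter> S \<sigma> \<in> (\<lambda>A. T ` A) ` ?Fr" by blast
      qed
      then have "card ((\<lambda>F. F \<inter> S \<sigma>) ` \<F>) \<le> card ((\<lambda>A. T ` A) ` ?Fr)"
        using fin by (intro card_mono) auto
      also have "\<dots> \<le> card ?Fr" by (rule card_image_le[OF fin])
      also have "\<dots> \<le> 2 ^ E" using spec[OF K, of j] by (simp add: E_def)
      finally show ?thesis .
    qed
    have "card \<F> ^ t \<le> (\<Prod>\<sigma>\<in>perms. card ((\<lambda>F. F \<inter> S \<sigma>) ` \<F>))"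
    proof (rule shearer_inequality[OF fin_V fin_perms t(1)])
      show "\<F> \<subseteq> Pow V" by (auto simp: \<F>_def V_def induced_free_families_def)
      show "t \<le> card {\<sigma> \<in> perms. X \<in> S \<sigma>}" if "X \<in> V" for X
        using t(2)[OF that] by (simp add: c_def)
    qed
    also have "\<dots> \<le> (\<Prod>\<sigma>\<in>perms. 2 ^ E)" using trace by (intro prod_mono) auto
    also have "\<dots> = 2 ^ (E * card perms)" by (simp add: power_mult)
    also have "\<dots> \<le> 2 ^ (K' * B * t)"
    proof (rule power_increasing)
      have "E * card perms \<le> K' * R * card perms" using E by simp
      also have "\<dots> = K' * (card perms * R)" by (simp add: mult_ac)
      also have "\<dots> \<le> K' * (t * B)" using t(3) by (rule mult_left_mono) simp
      finally show "E * card perms \<le> K' * B * t" by (simp add: mult_ac)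
    qed simp
    also have "\<dots> = (2 ^ (K' * B)) ^ t" by (simp add: power_mult)
    finally have "card \<F> \<le> 2 ^ (K' * B)" using t(1) by (simp add: power_mono_iff)
    then show ?thesis by (simp add: \<F>_def B_def)
  qed
  then show ?thesis by blast
qed

text \<open>Sets far from the middle are so few that all their subfamilies together contribute only a factor \<open>2\<close> to the
order of the central binomial coefficient.\<close>
lemma induced_free_families_bound:
  fixes P :: "'a::order set"
  assumes "finite P" "2 \<le> card P"
  shows "\<exists>K. \<forall>n\<ge>1. forb_star n P \<le> 2 ^ (K * (n choose (n div 2)))"
proof -
  obtain K where K: "\<forall>n\<ge>1. card {F \<in> induced_free_families n P. \<forall>X\<in>F. n \<le> 4 * card X \<and> 4 * card X \<le> 3 * n}
        \<le> 2 ^ (K * (n choose (n div 2)))"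
    using middle_families_bound[OF assms] by (elim exE)
  have "forb_star n P \<le> 2 ^ ((K + 8) * (n choose (n div 2)))" if n: "1 \<le> n" for n
  proof -
    define B where "B = n choose (n div 2)"
    define M where "M = {F \<in> induced_free_families n P. \<forall>X\<in>F. n \<le> 4 * card X \<and> 4 * card X \<le> 3 * n}"
    define far where "far = {X \<in> Pow {1..n}. 4 * card X < n \<or> 3 * n < 4 * card X}"
    define split where "split F = (F - far, F \<inter> far)" for F
    have "card far \<le> 8 * B"
      using card_far_from_middle[of "{1..n}"] n by (simp add: far_def B_def)
    moreover have fin_far: "finite far" by (simp add: far_def)
    ultimately have far: "card (Pow far) \<le> 2 ^ (8 * B)"
      by (simp add: card_Pow power_increasing)
    have fin_M: "finite M"
      using finite_induced_free_families[of n P] by (simp add: M_def)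
    have "forb_star n P \<le> card (M \<times> Pow far)"
      unfolding forb_star_def
    proof (rule card_inj_on_le)
      show "inj_on split (induced_free_families n P)"
        by (rule inj_onI) (auto simp: split_def)
      show "split ` induced_free_families n P \<subseteq> M \<times> Pow far"
      proof (rule image_subsetI)
        fix F assume F: "F \<in> induced_free_families n P"
        then have sub: "F \<subseteq> Pow {1..n}" and "\<not> contains_induced_copy F P"
          by (auto simp: induced_free_families_def)
        then have "\<not> contains_induced_copy (F - far) P"
          using contains_induced_copy_mono[of "F - far" P F] by auto
        then have "F - far \<in> M"
          using sub by (auto simp: M_def induced_free_families_def far_def not_less)
        then show "split F \<in> M \<times> Pow far" by (simp add: split_def)
      qed
      show "finite (M \<times> Pow far)" using fin_M fin_far by simp
    qed
    also have "\<dots> = card M * card (Pow far)" by (rule card_cartesian_product)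
    also have "\<dots> \<le> 2 ^ (K * B) * 2 ^ (8 * B)"
      using K n far by (intro mult_mono) (simp_all add: M_def B_def)
    also have "\<dots> = 2 ^ ((K + 8) * B)" by (simp add: power_add distrib_right)
    finally show ?thesis by (simp add: B_def)
  qed
  then show ?thesis by blast
qed

theorem theorem1p2:
  fixes P :: "'a::order set"
  assumes "finite P" and "\<not> is_antichain P"
  shows "\<exists>K::real. \<forall>n\<ge>1. real (forb_star n P) \<le> 2 powr (K * real (La_star n P))"
proof -
  obtain x y where xy: "x \<in> P" "y \<in> P" "x < y"
    using assms(2) by (auto simp: is_antichain_def)
  have "card {x, y} \<le> card P" using assms(1) xy by (intro card_mono) auto
  then have "2 \<le> card P" using xy(3) by simp
  then have "\<exists>K. \<forall>n\<ge>1. forb_star n P \<le> 2 ^ (K * (n choose (n div 2)))"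
    by (rule induced_free_families_bound[OF assms(1)])
  then obtain K where K: "\<forall>n\<ge>1. forb_star n P \<le> 2 ^ (K * (n choose (n div 2)))"
    by (elim exE)
  have "real (forb_star n P) \<le> 2 powr (real K * real (La_star n P))" if n: "1 \<le> n" for n
  proof -
    have "K * (n choose (n div 2)) \<le> K * La_star n P"
      by (intro mult_left_mono middle_binomial_le_La_star assms(2)) simp
    then have "(2::nat) ^ (K * (n choose (n div 2))) \<le> 2 ^ (K * La_star n P)"
      by (rule power_increasing) simp
    with K n have "forb_star n P \<le> 2 ^ (K * La_star n P)"
      using order_trans by blast
    then have "real (forb_star n P) \<le> real (2 ^ (K * La_star n P))"
      by (simp only: of_nat_le_iff)
    also have "\<dots> = 2 powr (real K * real (La_star n P))"
      by (simp add: powr_realpow[of 2, symmetric])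
    finally show ?thesis .
  qed
  then show ?thesis by blast
qed

end
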